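(* Let $\mathbb{X}$ be a real Banach space. Then $x \in \mathbb{X}$ is a left-symmetric point in $\mathbb{X}$ if and only if for every $u \in \mathbb{X}$ the following two conditions hold: (i) $u \in x^{-}$ implies that $x \in u^{-}$; (ii) $u \in x^{+}$ implies that $x \in u^{+}$.
   Context: For $x,y$ in a real Banach space $\mathbb{X}$, $x$ is Birkhoff-James orthogonal to $y$, written $x \perp_B y$, if $\|x+\lambda y\| \geq \|x\|$ for all $\lambda \in \mathbb{R}$. An element $x \in \mathbb{X}$ is a left-symmetric point in $\mathbb{X}$ if for every $y \in \mathbb{X}$, $x \perp_B y$ implies $y \perp_B x$. For $x \in \mathbb{X}$, define $x^{+} = \{y \in \mathbb{X} : \|x+\lambda y\| \geq \|x\| \text{ for all } \lambda \geq 0\}$ and $x^{-} = \{y \in \mathbb{X} : \|x+\lambda y\| \geq \|x\| \text{ for all } \lambda \leq 0\}$. *)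

theory Defs
  imports "HOL-Analysis.Analysis"
begin

definition BJ_orthogonal :: "'a::real_normed_vector \<Rightarrow> 'a \<Rightarrow> bool"  (infix "\<bottom>\<^sub>B" 50)
  where "x \<bottom>\<^sub>B y \<longleftrightarrow> (\<forall>l::real. norm (x + l *\<^sub>R y) \<ge> norm x)"

definition left_symmetric_point :: "'a::real_normed_vector \<Rightarrow> bool"
  where "left_symmetric_point x \<longleftrightarrow> (\<forall>y. x \<bottom>\<^sub>B y \<longrightarrow> y \<bottom>\<^sub>B x)"

text \<open>The sets $x^+$ and $x^-$.\<close>

definition BJ_plus :: "'a::real_normed_vector \<Rightarrow> 'a set"
  where "BJ_plus x = {y. \<forall>l::real. l \<ge> 0 \<longrightarrow> norm (x + l *\<^sub>R y) \<ge> norm x}"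

definition BJ_minus :: "'a::real_normed_vector \<Rightarrow> 'a set"
  where "BJ_minus x = {y. \<forall>l::real. l \<le> 0 \<longrightarrow> norm (x + l *\<^sub>R y) \<ge> norm x}"

end

(* If x is left-symmetric and u lies in x^- but not in x^+, then the norm has a support line of
   negative slope at x in direction u, so x is Birkhoff-James orthogonal to u + d x for some d > 0.
   Left symmetry says that the convex function s |-> norm (u + s x) attains its minimum at d > 0;
   hence it does not fall below its value at 0 when s <= 0, i.e. x lies in u^-. *)

theory Submission
  imports Defs
begin

text \<open>Convexity of the norm: \<open>x\<close> is the convex combination of
  \<open>x + s *\<^sub>R u\<close> and \<open>x + t *\<^sub>R u\<close> with weights proportional to
  \<open>t\<close> and \<open>- s\<close>.\<close>

lemma norm_slope_mono:
  fixes x u :: "'a::real_normed_vector"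
  assumes "s < 0" "0 < t"
  shows "(norm (x + s *\<^sub>R u) - norm x) / s \<le> (norm (x + t *\<^sub>R u) - norm x) / t"
proof -
  have "(t - s) *\<^sub>R x = t *\<^sub>R (x + s *\<^sub>R u) + (- s) *\<^sub>R (x + t *\<^sub>R u)"
    by (simp add: algebra_simps)
  then have "norm ((t - s) *\<^sub>R x) \<le> norm (t *\<^sub>R (x + s *\<^sub>R u)) + norm ((- s) *\<^sub>R (x + t *\<^sub>R u))"
    by (metis norm_triangle_ineq)
  then have "(t - s) * norm x \<le> t * norm (x + s *\<^sub>R u) - s * norm (x + t *\<^sub>R u)"
    using assms by simp
  then show ?thesis
    using assms by (simp add: field_simps)
qed

lemma norm_support_line:
  fixes x u :: "'a::real_normed_vector"
  obtains m where "\<And>t. norm x + t * m \<le> norm (x + t *\<^sub>R u)"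
proof
  define q where "q t = (norm (x + t *\<^sub>R u) - norm x) / t" for t
  \<comment> \<open>This is the right derivative of the norm at \<open>x\<close> along
    \<open>u\<close>. Every left slope bounds the right slopes from below, so the infimum is finite
    and dominates all left slopes.\<close>
  define m where "m = Inf (q ` {0<..})"
  fix t :: real
  have mono: "q s \<le> q t" if "s < 0" "0 < t" for s t
    unfolding q_def using that by (rule norm_slope_mono)
  consider "t < 0" | "t = 0" | "0 < t" by linarith
  then show "norm x + t * m \<le> norm (x + t *\<^sub>R u)"
  proof cases
    case 1
    have "q t \<le> m"
      unfolding m_def using mono[OF 1] by (intro cInf_greatest) auto
    then show ?thesis
      using 1 by (simp add: q_def field_simps)
  next
    case 3
    have "bdd_below (q ` {0<..})"
      using mono[of "-1"] by (intro bdd_belowI[of _ "q (-1)"]) auto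
    then have "m \<le> q t"
      unfolding m_def using 3 by (intro cInf_lower) auto
    then show ?thesis
      using 3 by (simp add: q_def field_simps)
  qed simp
qed

lemma norm_convex_on_line:
  fixes x y :: "'a::real_normed_vector"
  assumes "0 \<le> r" "r \<le> 1"
  shows "norm (x + (r * l) *\<^sub>R y) \<le> (1 - r) * norm x + r * norm (x + l *\<^sub>R y)"
proof -
  have "x + (r * l) *\<^sub>R y = (1 - r) *\<^sub>R x + r *\<^sub>R (x + l *\<^sub>R y)"
    by (simp add: algebra_simps)
  then show ?thesis
    using assms norm_triangle_ineq[of "(1 - r) *\<^sub>R x" "r *\<^sub>R (x + l *\<^sub>R y)"] by simp
qed

text \<open>A norming functional of \<open>x\<close> with value \<open>c * norm x\<close> at
  \<open>u\<close> would vanish at \<open>u - c *\<^sub>R x\<close>. The support line takes the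
  place of that functional.\<close>

lemma BJ_orthogonal_of_support_line:
  fixes x u :: "'a::real_normed_vector"
  assumes line: "\<And>t. norm x + t * (c * norm x) \<le> norm (x + t *\<^sub>R u)"
  shows "x \<bottom>\<^sub>B (u - c *\<^sub>R x)"
  unfolding BJ_orthogonal_def
proof
  fix l :: real
  let ?y = "u - c *\<^sub>R x"
  have small: "norm x \<le> norm (x + k *\<^sub>R ?y)" if "k * c < 1" for k
  proof -
    \<comment> \<open>Collecting multiples of \<open>x\<close> turns
      \<open>x + k *\<^sub>R ?y\<close> into \<open>a *\<^sub>R x + k *\<^sub>R u\<close>. As
      \<open>a\<close> is positive it factors out, and the support line applies at
      \<open>k / a\<close>.\<close>
    define a where "a = 1 - k * c"
    have a: "0 < a" using that by (simp add: a_def)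
    have "norm x = a * (norm x + (k / a) * (c * norm x))"
      using a by (simp add: field_simps) (simp add: a_def algebra_simps)
    also have "\<dots> \<le> a * norm (x + (k / a) *\<^sub>R u)"
      using line[of "k / a"] a by (intro mult_left_mono) auto
    also have "\<dots> = norm (a *\<^sub>R (x + (k / a) *\<^sub>R u))"
      using a by simp
    also have "a *\<^sub>R (x + (k / a) *\<^sub>R u) = x + k *\<^sub>R ?y"
      using a by (simp add: scaleR_add_right) (simp add: a_def algebra_simps)
    finally show ?thesis .
  qed
  \<comment> \<open>Shrinking \<open>l\<close> by this factor gives \<open>r * l * c < 1\<close>,
    whatever the sign of \<open>l * c\<close>. Convexity then carries the bound from
    \<open>r * l\<close> out to \<open>l\<close>.\<close>
  define r where "r = 1 / (1 + \<bar>l * c\<bar>)"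
  have r: "0 < r" "r \<le> 1"
    by (auto simp: r_def)
  have "r * l * c < 1"
    by (auto simp: r_def field_simps add_pos_nonneg)
  then have "norm x \<le> norm (x + (r * l) *\<^sub>R ?y)"
    by (rule small)
  also have "\<dots> \<le> (1 - r) * norm x + r * norm (x + l *\<^sub>R ?y)"
    using r by (intro norm_convex_on_line) auto
  finally have "r * norm x \<le> r * norm (x + l *\<^sub>R ?y)"
    by (simp add: algebra_simps)
  then show "norm x \<le> norm (x + l *\<^sub>R ?y)"
    using r by simp
qed

lemma BJ_orthogonal_iff: "x \<bottom>\<^sub>B y \<longleftrightarrow> y \<in> BJ_plus x \<and> y \<in> BJ_minus x"
  unfolding BJ_orthogonal_def BJ_plus_def BJ_minus_def using linear[of "0::real"] by blast

text \<open>The norm drops below \<open>norm x\<close> at some positive \<open>t\<close>, so a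
  support line must have negative slope \<open>m\<close>; the shift is
  \<open>d = - (m / norm x)\<close>.\<close>

lemma BJ_orthogonal_of_not_plus:
  assumes "u \<notin> BJ_plus x" "x \<noteq> 0"
  obtains d where "0 < d" "x \<bottom>\<^sub>B (u + d *\<^sub>R x)"
proof -
  obtain m where m: "\<And>t. norm x + t * m \<le> norm (x + t *\<^sub>R u)"
    using norm_support_line by blast
  obtain t where t: "0 \<le> t" "norm (x + t *\<^sub>R u) < norm x"
    using assms by (auto simp: BJ_plus_def not_le)
  then have "t * m < 0"
    using m[of t] by linarith
  then have "m < 0"
    using t by (simp add: mult_less_0_iff)
  then have "0 < - (m / norm x)"
    using assms by (simp add: divide_neg_pos)
  moreover have "x \<bottom>\<^sub>B (u - (m / norm x) *\<^sub>R x)"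
    using m assms by (intro BJ_orthogonal_of_support_line) simp
  ultimately show thesis
    using that[of "- (m / norm x)"] by simp
qed

lemma BJ_minus_of_shifted_orthogonal:
  assumes "0 < d" "(u + d *\<^sub>R x) \<bottom>\<^sub>B x"
  shows "x \<in> BJ_minus u"
  unfolding BJ_minus_def
proof (safe)
  fix s :: real
  assume s: "s \<le> 0"
  \<comment> \<open>The weight that writes 0 as a convex combination of \<open>d\<close> and
    \<open>s\<close>, so that \<open>u\<close> lies on the segment from
    \<open>u + d *\<^sub>R x\<close> to \<open>u + s *\<^sub>R x\<close>.\<close>
  define r where "r = d / (d - s)"
  have r: "0 < r" "r \<le> 1" "(1 - r) * d + r * s = 0"
    using assms s by (auto simp: r_def field_simps)
  let ?v = "u + d *\<^sub>R x"
  have at_s: "?v + (s - d) *\<^sub>R x = u + s *\<^sub>R x"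
    by (simp add: algebra_simps)
  have at_0: "?v + (r * (s - d)) *\<^sub>R x = u"
  proof -
    have "d + r * (s - d) = 0" using r by (simp add: algebra_simps)
    then show ?thesis by (metis add.assoc add.right_neutral scaleR_add_left scaleR_zero_left)
  qed
  have "norm ?v \<le> norm (u + s *\<^sub>R x)"
    using assms(2) at_s unfolding BJ_orthogonal_def by metis
  moreover have "norm u \<le> (1 - r) * norm ?v + r * norm (u + s *\<^sub>R x)"
    using norm_convex_on_line[of r ?v "s - d" x] r at_s at_0 by simp
  ultimately show "norm u \<le> norm (u + s *\<^sub>R x)"
    using r mult_left_mono[of "norm ?v" "norm (u + s *\<^sub>R x)" "1 - r"]
    by (simp add: algebra_simps)
qed

lemma left_symmetric_point_minus:
  assumes "left_symmetric_point x" "u \<in> BJ_minus x"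
  shows "x \<in> BJ_minus u"
\<comment> \<open>If \<open>u\<close> is in both half-sets, then
  \<open>x \<bottom>\<^sub>B u\<close> and left symmetry applies without a shift; for
  \<open>x = 0\<close> the claim is trivial.\<close>
proof (cases "u \<in> BJ_plus x \<or> x = 0")
  case True
  then show ?thesis
    using assms by (auto simp: left_symmetric_point_def BJ_orthogonal_iff BJ_minus_def[of u])
next
  case False
  then obtain d where "0 < d" "x \<bottom>\<^sub>B (u + d *\<^sub>R x)"
    using BJ_orthogonal_of_not_plus by blast
  then show ?thesis
    using assms(1) BJ_minus_of_shifted_orthogonal by (auto simp: left_symmetric_point_def)
qed

text \<open>The substitution of \<open>- l\<close> for \<open>l\<close>. With the next lemma it
  reduces condition (ii) to condition (i).\<close>

lemma minus_mem_BJ_minus_iff: "- u \<in> BJ_minus x \<longleftrightarrow> u \<in> BJ_plus x"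
  unfolding BJ_minus_def BJ_plus_def
proof (safe)
  fix l :: real
  assume h: "\<forall>l\<le>0. norm x \<le> norm (x + l *\<^sub>R (- u))" and l: "0 \<le> l"
  show "norm x \<le> norm (x + l *\<^sub>R u)"
    using h[rule_format, of "- l"] l by simp
next
  fix l :: real
  assume h: "\<forall>l\<ge>0. norm x \<le> norm (x + l *\<^sub>R u)" and l: "l \<le> 0"
  show "norm x \<le> norm (x + l *\<^sub>R (- u))"
    using h[rule_format, of "- l"] l by simp
qed

lemma mem_BJ_minus_minus_iff: "x \<in> BJ_minus (- u) \<longleftrightarrow> x \<in> BJ_plus u"
proof -
  have "norm (- u + l *\<^sub>R x) = norm (u + l *\<^sub>R (- x))" for l
    by (metis minus_add_distrib add.inverse_inverse norm_minus_cancel scaleR_minus_right)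
  then have "x \<in> BJ_minus (- u) \<longleftrightarrow> - x \<in> BJ_minus u"
    by (simp add: BJ_minus_def)
  then show ?thesis
    by (simp add: minus_mem_BJ_minus_iff)
qed

theorem theorem2p1:
  fixes x :: "'a::banach"
  shows "left_symmetric_point x \<longleftrightarrow>
    (\<forall>u. (u \<in> BJ_minus x \<longrightarrow> x \<in> BJ_minus u) \<and> (u \<in> BJ_plus x \<longrightarrow> x \<in> BJ_plus u))"
proof
  assume "left_symmetric_point x"
  then show "\<forall>u. (u \<in> BJ_minus x \<longrightarrow> x \<in> BJ_minus u) \<and> (u \<in> BJ_plus x \<longrightarrow> x \<in> BJ_plus u)"
    \<comment> \<open>For the plus half, \<open>left_symmetric_point_minus\<close> is applied to
      \<open>- u\<close>.\<close>
    by (metis left_symmetric_point_minus minus_mem_BJ_minus_iff mem_BJ_minus_minus_iff)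
next
  assume "\<forall>u. (u \<in> BJ_minus x \<longrightarrow> x \<in> BJ_minus u) \<and> (u \<in> BJ_plus x \<longrightarrow> x \<in> BJ_plus u)"
  then show "left_symmetric_point x"
    \<comment> \<open>Orthogonality is membership in both half-sets, and each condition transfers
      one of them.\<close>
    by (simp add: left_symmetric_point_def BJ_orthogonal_iff)
qed

end
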